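(* Let $X$ be a $\mathcal K$-analytic space, $Y\supset X$ a space, and $\alpha\le\omega_1$. The following are equivalent: (1) $X\in\mathcal F_\alpha(Y)$; (2) $X=\mathbf R_\alpha(\mathcal C)$ for some Suslin scheme $\mathcal C$ in $Y$ consisting of closed subsets of $Y$; (3) $X=\mathbf R_\alpha(\mathcal C,Y)$ for some Suslin scheme $\mathcal C$ in $X$; (4) $X=\mathbf R_\alpha(\mathcal C,Y)$ for some Suslin scheme $\mathcal C$ which is complete on $X$.
   Context: All spaces Tychonoff. $\mathcal F$-Borel hierarchy: $\mathcal F_0(Y)$ closed sets; for $0<\alpha<\omega_1$, $\mathcal F_\alpha(Y)$ = countable unions (odd $\alpha$) or intersections (even $\alpha$) of members of $\bigcup_{\beta<\alpha}\mathcal F_\beta(Y)$ ($\lambda+m$ has the parity of $m$); $\mathcal F_{\omega_1}(Y)$ = Suslin-$\mathcal F$ subsets $\bigcup_{\sigma\in\omega^\omega}\bigcap_kF_{\sigma(0),\dots,\sigma(k)}$, $F$ closed. $\mathcal K$-analytic: Suslin-$\mathcal F$ in some compact space. Suslin scheme in $Y$: $\mathcal C=(C(s))_{s\in\omega^{<\omega}}$, $C(s)\subset Y$, $C(t)\subset C(s)$ if $t$ extends $s$; $\mathcal A(\mathcal C)=\bigcup_{\sigma\in\omega^\omega}\bigcap_nC(\sigma|n)$. $\mathcal C$ is complete on $X$ if it is a Suslin scheme in $X$ with $\mathcal A(\mathcal C)=X$ and every filter on $X$ containing, for each $n$, some set $C(s)$ with $|s|=n$, has an accumulation point in $X$. $\overline{\mathcal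 C}^Y=(\overline{C(s)\cap Y}^Y)_s$. Admissible maps $\varphi:T\to\omega^{<\omega}$: monotone w.r.t. extension with $|\varphi(t)|=t(0)+\dots+t(k)$. $\mathbf R_T(\mathcal D)=\{x\in D(\emptyset):\exists$ admissible $\varphi:T\to\omega^{<\omega}$ with $x\in D(\varphi(t))\ \forall t\in T\}$; $\mathbf R_T(\mathcal C,Y)=\mathbf R_T(\overline{\mathcal C}^Y)$. Trees $T_\beta$: fixed bijections $\pi_\beta:\omega\to\beta$ for countable limit $\beta$; $T_0=\{\emptyset\}$, $T_\beta=\{\emptyset\}\cup\bigcup_nn^\frown T_{\beta-1}$ (successor), $T_\beta=\{\emptyset\}\cup\bigcup_nn^\frown T_{\pi_\beta(n)}$ (limit), $T_{\omega_1}=\omega^{<\omega}$, where $n^\frown S=\{(n)^\frown s:s\in S\}$. For $\alpha=\lambda+2n+i$ ($\lambda$ limit or 0, $i\in\{0,1\}$) put $\alpha'=\lambda+n$; canonical trees: $T^c_\alpha=T_{\alpha'}$ for even $\alpha\le\omega_1$ (in particular $T^c_{\omega_1}=\omega^{<\omega}$), $T^c_\alpha=\{\emptyset\}\cup1^\frown T_{\alpha'}$ for odd $\alpha$. $\mathbf R_\alpha(\cdot)=\mathbf R_{T^c_\alpha}(\cdot)$ and $\mathbf R_\alpha(\mathcal C,Y)=\mathbf R_{T^c_\alpha}(\mathcal C,Y)$. *)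

theory Defs
  imports "HOL-Analysis.Analysis" "HOL-Library.Sublist"
begin

definition tychonoff_space :: "'a topology \<Rightarrow> bool" where
  "tychonoff_space Y \<longleftrightarrow> completely_regular_space Y \<and> Hausdorff_space Y"

text \<open>We work in a well-ordered type 'o together with an element w1 such that every
  element is below w1, w1 has uncountably many predecessors and every element below
  w1 has countably many predecessors; then 'o is order-isomorphic to omega_1 + 1.\<close>

definition omega1_top :: "'o::wellorder \<Rightarrow> bool" where
  "omega1_top w1 \<longleftrightarrow> (\<forall>x. x \<le> w1) \<and> \<not> countable {x. x < w1}
      \<and> (\<forall>x. x < w1 \<longrightarrow> countable {y. y < x})"

definition ozero :: "'o::wellorder" where
  "ozero = (LEAST x. True)"

definition osucc :: "'o::wellorder \<Rightarrow> 'o" where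
  "osucc x = (LEAST y. x < y)"

definition opred :: "'o::wellorder \<Rightarrow> 'o" where
  "opred x = (GREATEST y. y < x)"

definition is_limit :: "'o::wellorder \<Rightarrow> bool" where
  "is_limit x \<longleftrightarrow> ozero < x \<and> (\<forall>y. y < x \<longrightarrow> (\<exists>z. y < z \<and> z < x))"

text \<open>Writing alpha = lambda + m with lambda limit or 0 and m finite.\<close>

definition lam_of :: "'o::wellorder \<Rightarrow> 'o" where
  "lam_of \<alpha> = (GREATEST l. l \<le> \<alpha> \<and> (l = ozero \<or> is_limit l))"

definition fin_of :: "'o::wellorder \<Rightarrow> nat" where
  "fin_of \<alpha> = card {y. lam_of \<alpha> \<le> y \<and> y < \<alpha>}"

definition oprime :: "'o::wellorder \<Rightarrow> 'o" where
  "oprime \<alpha> = (osucc ^^ (fin_of \<alpha> div 2)) (lam_of \<alpha>)"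

definition suslinF :: "'a topology \<Rightarrow> 'a set \<Rightarrow> bool" where
  "suslinF Y A \<longleftrightarrow> (\<exists>F :: nat list \<Rightarrow> 'a set. (\<forall>s. closedin Y (F s)) \<and>
      A = (\<Union>\<sigma>. \<Inter>k. F (map \<sigma> [0..<Suc k])))"

inductive Fborel :: "'a topology \<Rightarrow> 'o::wellorder \<Rightarrow> 'o \<Rightarrow> 'a set \<Rightarrow> bool"
  for Y :: "'a topology" and w1 :: "'o::wellorder" where
  F_zero: "closedin Y A \<Longrightarrow> Fborel Y w1 ozero A"
| F_odd: "\<lbrakk>ozero < \<alpha>; \<alpha> < w1; odd (fin_of \<alpha>);
           \<And>n::nat. \<beta> n < \<alpha> \<and> Fborel Y w1 (\<beta> n) (A n)\<rbrakk>
          \<Longrightarrow> Fborel Y w1 \<alpha> (\<Union>n. A n)"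
| F_even: "\<lbrakk>ozero < \<alpha>; \<alpha> < w1; even (fin_of \<alpha>);
           \<And>n::nat. \<beta> n < \<alpha> \<and> Fborel Y w1 (\<beta> n) (A n)\<rbrakk>
          \<Longrightarrow> Fborel Y w1 \<alpha> (\<Inter>n. A n)"
| F_omega1: "suslinF Y A \<Longrightarrow> Fborel Y w1 w1 A"

text \<open>X (a subspace of some space) is Suslin-F in the compact space K via the embedding e.
  K-analyticity of X means this holds for some compact (Hausdorff) K and some e.\<close>
definition K_analytic_via :: "'k topology \<Rightarrow> ('a \<Rightarrow> 'k) \<Rightarrow> 'a topology \<Rightarrow> bool" where
  "K_analytic_via K e X \<longleftrightarrow> compact_space K \<and> tychonoff_space K \<and>
     homeomorphic_map X (subtopology K (e ` topspace X)) e \<and> suslinF K (e ` topspace X)"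

definition suslin_scheme :: "'a set \<Rightarrow> (nat list \<Rightarrow> 'a set) \<Rightarrow> bool" where
  "suslin_scheme S C \<longleftrightarrow> (\<forall>s. C s \<subseteq> S) \<and> (\<forall>s t. prefix s t \<longrightarrow> C t \<subseteq> C s)"

definition suslin_op :: "(nat list \<Rightarrow> 'a set) \<Rightarrow> 'a set" where
  "suslin_op C = (\<Union>\<sigma>. \<Inter>n. C (map \<sigma> [0..<n]))"

text \<open>Completeness on the space X (given as a topology whose carrier is X).
  Filters on X are proper HOL filters containing X; an accumulation point is a point in
  the closure of every member of the filter.\<close>
definition complete_on :: "'a topology \<Rightarrow> (nat list \<Rightarrow> 'a set) \<Rightarrow> bool" where
  "complete_on X C \<longleftrightarrow> suslin_scheme (topspace X) C \<and> suslin_op C = topspace X \<and>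
     (\<forall>F. F \<noteq> bot \<and> eventually (\<lambda>x. x \<in> topspace X) F \<and>
          (\<forall>n. \<exists>s. length s = n \<and> eventually (\<lambda>x. x \<in> C s) F)
        \<longrightarrow> (\<exists>x\<in>topspace X. \<forall>A. eventually (\<lambda>x. x \<in> A) F \<longrightarrow> x \<in> X closure_of A))"

definition closure_scheme :: "'a topology \<Rightarrow> (nat list \<Rightarrow> 'a set) \<Rightarrow> nat list \<Rightarrow> 'a set" where
  "closure_scheme Y C s = Y closure_of (C s \<inter> topspace Y)"

inductive inT :: "'o::wellorder \<Rightarrow> ('o \<Rightarrow> nat \<Rightarrow> 'o) \<Rightarrow> 'o \<Rightarrow> nat list \<Rightarrow> bool"
  for w1 :: "'o::wellorder" and \<pi> :: "'o \<Rightarrow> nat \<Rightarrow> 'o" where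
  T_nil: "inT w1 \<pi> \<beta> []"
| T_top: "inT w1 \<pi> w1 s"
| T_succ: "\<lbrakk>\<beta> < w1; ozero < \<beta>; \<not> is_limit \<beta>; inT w1 \<pi> (opred \<beta>) s\<rbrakk>
           \<Longrightarrow> inT w1 \<pi> \<beta> (n # s)"
| T_lim: "\<lbrakk>\<beta> < w1; is_limit \<beta>; inT w1 \<pi> (\<pi> \<beta> n) s\<rbrakk>
           \<Longrightarrow> inT w1 \<pi> \<beta> (n # s)"

definition tree :: "'o::wellorder \<Rightarrow> ('o \<Rightarrow> nat \<Rightarrow> 'o) \<Rightarrow> 'o \<Rightarrow> nat list set" where
  "tree w1 \<pi> \<beta> = {s. inT w1 \<pi> \<beta> s}"

definition canon_tree :: "'o::wellorder \<Rightarrow> ('o \<Rightarrow> nat \<Rightarrow> 'o) \<Rightarrow> 'o \<Rightarrow> nat list set" where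
  "canon_tree w1 \<pi> \<alpha> =
     (if even (fin_of \<alpha>) then tree w1 \<pi> (oprime \<alpha>)
      else {[]} \<union> {1 # s | s. s \<in> tree w1 \<pi> (oprime \<alpha>)})"

definition admissible :: "nat list set \<Rightarrow> (nat list \<Rightarrow> nat list) \<Rightarrow> bool" where
  "admissible T \<phi> \<longleftrightarrow> (\<forall>s\<in>T. \<forall>t\<in>T. prefix s t \<longrightarrow> prefix (\<phi> s) (\<phi> t)) \<and>
     (\<forall>t\<in>T. length (\<phi> t) = sum_list t)"

definition R_T :: "nat list set \<Rightarrow> (nat list \<Rightarrow> 'a set) \<Rightarrow> 'a set" where
  "R_T T D = {x \<in> D []. \<exists>\<phi>. admissible T \<phi> \<and> (\<forall>t\<in>T. x \<in> D (\<phi> t))}"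

definition R_alpha :: "'o::wellorder \<Rightarrow> ('o \<Rightarrow> nat \<Rightarrow> 'o) \<Rightarrow> 'o \<Rightarrow> (nat list \<Rightarrow> 'a set) \<Rightarrow> 'a set" where
  "R_alpha w1 \<pi> \<alpha> D = R_T (canon_tree w1 \<pi> \<alpha>) D"

definition R_alpha_in :: "'o::wellorder \<Rightarrow> ('o \<Rightarrow> nat \<Rightarrow> 'o) \<Rightarrow> 'o \<Rightarrow> (nat list \<Rightarrow> 'a set) \<Rightarrow> 'a topology \<Rightarrow> 'a set" where
  "R_alpha_in w1 \<pi> \<alpha> C Y = R_T (canon_tree w1 \<pi> \<alpha>) (closure_scheme Y C)"

end

theory Submission
  imports Defs "HOL-Library.Nat_Bijection"
begin

text \<open>
  The trees unfold recursively: \<open>\<^bold>R\<^sub>T(C)\<close> is the intersection over \<open>n\<close> of the unions, over words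
  \<open>u\<close> of length \<open>n\<close>, of the sets \<open>\<^bold>R\<close> of the shifted schemes \<open>C(u @ _)\<close> for the subtree above
  \<open>n\<close>. Hence every step in \<open>\<alpha>'\<close> costs one union and one intersection of the Borel hierarchy.
  Conversely, an \<open>\<F>\<^sub>\<alpha>\<close> set \<open>X\<close> is represented by a closed scheme \<open>C\<close> satisfying both
  \<open>X = \<^bold>R\<^sub>\<alpha>(C)\<close> and \<open>X = \<A>(C)\<close>. The second equation is what allows \<open>C\<close> to be intersected with
  a complete scheme \<open>D\<close> on \<open>X\<close>: for the resulting scheme \<open>E\<close>, still with \<open>\<A>(E) = X\<close>, one gets
  \<open>X = \<A>(E) \<subseteq> \<^bold>R\<^sub>\<alpha>(E, Y) \<subseteq> \<^bold>R\<^sub>\<alpha>(C) = X\<close>.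
\<close>

section \<open>Ordinals up to \<open>\<omega>\<^sub>1\<close>\<close>

lemma ozero_le [simp]: "ozero \<le> x"
  unfolding ozero_def by (rule Least_le) simp

text \<open>The witness \<open>z\<close> keeps the set under \<open>LEAST\<close> nonempty; at a
  greatest element such as \<open>w1\<close> the value of \<open>osucc\<close> is
  unspecified.\<close>

lemma less_osucc: "x < z \<Longrightarrow> x < osucc x"
  unfolding osucc_def by (rule LeastI)

lemma osucc_le: "x < z \<Longrightarrow> osucc x \<le> z"
  unfolding osucc_def by (rule Least_le)

lemma less_osucc_iff: "x < z \<Longrightarrow> y < osucc x \<longleftrightarrow> y \<le> x"
  by (meson leD le_less_trans less_osucc not_le osucc_le)

lemma opred_osucc: "x < z \<Longrightarrow> opred (osucc x) = x"
  unfolding opred_def by (rule Greatest_equality) (auto simp: less_osucc less_osucc_iff)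

lemma not_is_limit_osucc: "x < z \<Longrightarrow> \<not> is_limit (osucc x)"
  by (metis is_limit_def less_osucc less_osucc_iff leD)

lemma ozero_less_osucc: "x < z \<Longrightarrow> ozero < osucc x"
  by (simp add: less_osucc_iff)

lemma not_is_limit_ozero: "\<not> is_limit ozero"
  by (simp add: is_limit_def)

lemma wellorder_cases:
  obtains (zero) "x = ozero" | (lim) "is_limit x" | (succ) y where "y < x" "x = osucc y"
proof (cases "x = ozero \<or> is_limit x")
  case False
  then have "ozero < x"
    by (metis ozero_le order_le_less)
  with False obtain y where y: "y < x" "\<And>z. y < z \<Longrightarrow> \<not> z < x"
    by (auto simp: is_limit_def)
  then have "x = osucc y"
    using less_osucc[OF y(1)] osucc_le[OF y(1)] by (metis order_le_less)
  with y that show thesis by blast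
qed (use that in blast)

lemma lam_of_limit: "x = ozero \<or> is_limit x \<Longrightarrow> lam_of x = x"
  unfolding lam_of_def by (rule Greatest_equality) auto

lemma fin_of_limit: "x = ozero \<or> is_limit x \<Longrightarrow> fin_of x = 0"
  by (simp add: fin_of_def lam_of_limit flip: not_less)

lemma oprime_limit: "x = ozero \<or> is_limit x \<Longrightarrow> oprime x = x"
  by (simp add: oprime_def fin_of_limit lam_of_limit)

lemma lam_of_osucc:
  assumes "x < z"
  shows "lam_of (osucc x) = lam_of x"
proof -
  have "l \<le> osucc x \<and> (l = ozero \<or> is_limit l) \<longleftrightarrow> l \<le> x \<and> (l = ozero \<or> is_limit l)" for l
    using assms not_is_limit_osucc[OF assms] ozero_less_osucc[OF assms]
    by (metis less_osucc less_osucc_iff nle_le order_le_less)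
  then show ?thesis by (simp add: lam_of_def)
qed

text \<open>Well-founded induction: a successor inherits \<open>lam_of\<close> and adds one point to
  the interval. Finiteness makes the \<open>card\<close> in \<open>fin_of\<close> a genuine
  count.\<close>

lemma lam_of_le_finite: "lam_of x \<le> x \<and> finite {y. lam_of x \<le> y \<and> y < x}"
proof (induction x rule: less_induct)
  case (less x)
  show ?case
  proof (cases x rule: wellorder_cases)
    case (succ y)
    then have "{z. lam_of x \<le> z \<and> z < x} \<subseteq> insert y {z. lam_of y \<le> z \<and> z < y}"
      by (auto simp: lam_of_osucc[OF succ(1)] less_osucc_iff[OF succ(1)])
    with less.IH[OF succ(1)] have "finite {z. lam_of x \<le> z \<and> z < x}"
      by (auto elim: finite_subset)
    moreover have "lam_of x \<le> x"
      using less.IH[OF succ(1)] succ(1) lam_of_osucc[OF succ(1)] succ(2)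
      by (metis less_imp_le order_trans)
    ultimately show ?thesis by blast
  qed (auto simp: lam_of_limit simp flip: not_less)
qed

lemma fin_of_osucc:
  assumes "x < z"
  shows "fin_of (osucc x) = Suc (fin_of x)"
proof -
  have "{y. lam_of (osucc x) \<le> y \<and> y < osucc x} = insert x {y. lam_of x \<le> y \<and> y < x}"
    using lam_of_le_finite[of x] by (auto simp: lam_of_osucc[OF assms] less_osucc_iff[OF assms])
  then show ?thesis
    using lam_of_le_finite[of x] by (simp add: fin_of_def)
qed

text \<open>\<open>m div 2\<close> grows from \<open>m\<close> to \<open>m + 1\<close> exactly when
  \<open>m\<close> is odd.\<close>

lemma oprime_osucc:
  assumes "x < z"
  shows "oprime (osucc x) = (if even (fin_of x) then oprime x else osucc (oprime x))"
  by (auto simp: oprime_def fin_of_osucc[OF assms] lam_of_osucc[OF assms] elim!: oddE evenE)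

lemma odd_fin_of_cases:
  assumes "odd (fin_of x)"
  obtains y where "y < x" "x = osucc y" "even (fin_of y)"
  using assms by (cases x rule: wellorder_cases) (auto simp: fin_of_limit fin_of_osucc)

text \<open>The case split behind the inductions over even classes: beyond zero and limits they
  advance by double steps, one for a union and one for an intersection, while \<open>oprime\<close>
  advances by one.\<close>

lemma even_fin_of_cases:
  assumes "even (fin_of x)"
  obtains (zero) "x = ozero"
    | (lim) "is_limit x"
    | (succ) y where "y < osucc y" "osucc y < x" "x = osucc (osucc y)" "even (fin_of y)"
        "oprime x = osucc (oprime y)"
proof (cases x rule: wellorder_cases)
  case (succ y)
  then have "odd (fin_of y)"
    using assms by (simp add: fin_of_osucc)
  then obtain z where z: "z < y" "y = osucc z" "even (fin_of z)"
    by (rule odd_fin_of_cases)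
  have "oprime x = osucc (oprime y)"
    using \<open>odd (fin_of y)\<close> succ oprime_osucc[OF succ(1)] by simp
  also have "oprime y = oprime z"
    using z oprime_osucc[OF z(1)] by simp
  finally show thesis
    using succ z by (intro that(3)[of z]) simp_all
qed (use that in auto)

lemma oprime_le: "oprime x \<le> x"
proof (induction x rule: less_induct)
  case (less x)
  show ?case
  proof (cases x rule: wellorder_cases)
    case (succ y)
    then have "oprime y \<le> y" using less by simp
    moreover from this have "oprime y < x" using succ by simp
    ultimately show ?thesis
      using succ osucc_le[of "oprime y" x] by (auto simp: oprime_osucc[OF succ(1)])
  qed (auto simp: oprime_limit)
qed

section \<open>The top element \<open>w1\<close> as the first uncountable ordinal\<close>

locale omega1 =
  fixes w1 :: "'o::wellorder"
  assumes omega1_top: "omega1_top w1"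
begin

lemma le_w1 [simp]: "x \<le> w1"
  using omega1_top by (simp add: omega1_top_def)

lemma ozero_less_w1 [simp]: "ozero < w1"
proof (rule ccontr)
  assume "\<not> ozero < w1"
  then have "{x. x < w1} = {}" by (metis Collect_empty_eq le_less_trans ozero_le)
  then show False using omega1_top by (simp add: omega1_top_def)
qed

lemma w1_neq_ozero [simp]: "w1 \<noteq> ozero" "ozero \<noteq> w1"
  using ozero_less_w1 by (metis order_less_irrefl)+

text \<open>An immediate predecessor \<open>y\<close> would leave only \<open>y\<close> and its
  countably many predecessors below \<open>w1\<close>.\<close>

lemma is_limit_w1: "is_limit w1"
  unfolding is_limit_def
proof (intro conjI allI impI ozero_less_w1)
  fix y assume y: "y < w1"
  show "\<exists>z. y < z \<and> z < w1"
  proof (rule ccontr)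
    assume "\<nexists>z. y < z \<and> z < w1"
    then have "{x. x < w1} \<subseteq> insert y {x. x < y}" by (auto simp: not_less) (meson leD linorder_neqE)
    moreover have "countable (insert y {x. x < y})"
      using omega1_top y by (simp add: omega1_top_def)
    ultimately show False
      using omega1_top countable_subset unfolding omega1_top_def by blast
  qed
qed

end

lemma osucc_less_limit: "is_limit l \<Longrightarrow> x < l \<Longrightarrow> osucc x < l"
  unfolding is_limit_def by (meson le_less_trans osucc_le)

text \<open>Each step of \<open>d\<close> is matched by two steps of \<open>x\<close>, which stay
  below the limit. The bound \<open>d \<le> x\<close> later lets sets of class at most
  \<open>d\<close> count as sets of class \<open>x\<close>.\<close>

lemma even_preimage_oprime:
  assumes "is_limit l" "d < l"
  shows "\<exists>x. d \<le> x \<and> x < l \<and> even (fin_of x) \<and> oprime x = d"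
  using assms(2)
proof (induction d rule: less_induct)
  case (less d)
  show ?case
  proof (cases d rule: wellorder_cases)
    case (succ d')
    then obtain x where x: "d' \<le> x" "x < l" "even (fin_of x)" "oprime x = d'"
      using less by force
    let ?y = "osucc x"
    have y: "?y < l" "osucc ?y < l" using x assms by (auto intro: osucc_less_limit)
    have "d \<le> ?y" using succ x(1,2) by (metis le_less_trans less_osucc osucc_le)
    then have "d \<le> osucc ?y" using less_osucc[OF y(1)] by simp
    moreover have "fin_of (osucc ?y) = Suc (Suc (fin_of x))" "oprime (osucc ?y) = d"
      using x succ by (simp_all add: fin_of_osucc[OF y(1)] fin_of_osucc[OF x(2)]
          oprime_osucc[OF y(1)] oprime_osucc[OF x(2)])
    ultimately show ?thesis using x y by auto
  qed (use less.prems in \<open>auto simp: fin_of_limit oprime_limit\<close>)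
qed

text \<open>A finite tail would have a maximum, which a limit excludes. This supplies infinitely
  many slots at limit stages.\<close>

lemma infinite_above_limit:
  assumes "is_limit l" "x < l"
  shows "infinite {d. x \<le> d \<and> d < l}"
proof
  assume fin: "finite {d. x \<le> d \<and> d < l}"
  then have "Max {d. x \<le> d \<and> d < l} \<in> {d. x \<le> d \<and> d < l}"
    using assms by (intro Max_in) auto
  then obtain z where "Max {d. x \<le> d \<and> d < l} < z" "z < l"
    using assms(1) by (auto simp: is_limit_def)
  then show False
    using fin \<open>Max _ \<in> _\<close> by (metis (mono_tags, lifting) Max_ge leD mem_Collect_eq order.strict_implies_order order_le_less_trans)
qed

section \<open>Trees and the operation \<open>\<^bold>R\<close>\<close>

text \<open>Common shape of \<open>tree\<close> at successors (constant family) and at limits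
  (family along \<open>\<pi>\<close>), so that both can be treated at once.\<close>

definition node :: "(nat \<Rightarrow> nat list set) \<Rightarrow> nat list set" where
  "node T = insert [] {n # s | n s. s \<in> T n}"

lemma node_simps [simp]: "[] \<in> node T" "n # s \<in> node T \<longleftrightarrow> s \<in> T n"
  by (auto simp: node_def)

lemma Nil_in_tree [simp]: "[] \<in> tree w1 \<pi> d"
  by (simp add: tree_def inT.T_nil)

lemma tree_w1: "tree w1 \<pi> w1 = UNIV"
  by (auto simp: tree_def intro: inT.T_top)

lemma tree_ozero: "ozero < w1 \<Longrightarrow> tree w1 \<pi> ozero = {[]}"
  by (auto simp: tree_def not_is_limit_ozero intro: inT.T_nil elim: inT.cases)

lemma tree_osucc:
  assumes "osucc d < w1" "d < w1"
  shows "tree w1 \<pi> (osucc d) = node (\<lambda>n. tree w1 \<pi> d)"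
proof (rule set_eqI)
  fix s
  show "s \<in> tree w1 \<pi> (osucc d) \<longleftrightarrow> s \<in> node (\<lambda>n. tree w1 \<pi> d)"
  proof (cases s)
    case (Cons n t)
    have "inT w1 \<pi> (osucc d) (n # t) \<longleftrightarrow> inT w1 \<pi> d t"
      using assms not_is_limit_osucc[OF assms(2)] ozero_less_osucc[OF assms(2)] opred_osucc[OF assms(2)]
      by (subst inT.simps) auto
    with Cons show ?thesis by (simp add: tree_def)
  qed simp
qed

lemma tree_limit:
  assumes "is_limit d" "d < w1"
  shows "tree w1 \<pi> d = node (\<lambda>n. tree w1 \<pi> (\<pi> d n))"
proof (rule set_eqI)
  fix s
  show "s \<in> tree w1 \<pi> d \<longleftrightarrow> s \<in> node (\<lambda>n. tree w1 \<pi> (\<pi> d n))"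
  proof (cases s)
    case (Cons n t)
    have "inT w1 \<pi> d (n # t) \<longleftrightarrow> inT w1 \<pi> (\<pi> d n) t"
      using assms by (subst inT.simps) auto
    with Cons show ?thesis by (simp add: tree_def)
  qed simp
qed

section \<open>Admissible maps and the recursive unfolding of \<open>R_T\<close>\<close>

lemma admissible_prefix:
  "admissible T \<phi> \<Longrightarrow> s \<in> T \<Longrightarrow> t \<in> T \<Longrightarrow> prefix s t \<Longrightarrow> prefix (\<phi> s) (\<phi> t)"
  by (auto simp: admissible_def)

lemma admissible_length: "admissible T \<phi> \<Longrightarrow> t \<in> T \<Longrightarrow> length (\<phi> t) = sum_list t"
  by (auto simp: admissible_def)

lemma admissible_comp:
  assumes "admissible T \<phi>" "\<And>s t. prefix s t \<Longrightarrow> prefix (g s) (g t)" "\<And>s. length (g s) = length s"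
  shows "admissible T (g \<circ> \<phi>)"
  using assms by (auto simp: admissible_def)

lemma prefix_map_upt: "m \<le> n \<Longrightarrow> prefix (map \<sigma> [0..<m]) (map \<sigma> [0..<n])"
  by (metis le_add_diff_inverse map_append prefixI upt_add_eq_append zero_le)

text \<open>Along a branch \<open>\<sigma>\<close>, sending \<open>t\<close> to the initial segment
  of length \<open>sum_list t\<close> is admissible on every tree.\<close>

lemma suslin_op_subset_R_T: "suslin_op D \<subseteq> R_T T D"
proof
  fix x assume "x \<in> suslin_op D"
  then obtain \<sigma> where \<sigma>: "\<And>n. x \<in> D (map \<sigma> [0..<n])"
    by (auto simp: suslin_op_def)
  have "sum_list s \<le> sum_list t" if "prefix s t" for s t :: "nat list"
    using that by (auto simp: prefix_def)
  then have "admissible T (\<lambda>t. map \<sigma> [0..<sum_list t])"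
    by (auto simp: admissible_def intro: prefix_map_upt)
  then show "x \<in> R_T T D"
    using \<sigma> \<sigma>[of 0] unfolding R_T_def by auto
qed

text \<open>The word of \<open>n\<close> ones has sum \<open>n\<close>, so an admissible map sends
  these words to a chain with one word of every length, that is, to a branch.\<close>

lemma R_T_UNIV: "R_T UNIV D = suslin_op D"
proof
  show "R_T UNIV D \<subseteq> suslin_op D"
  proof
    fix x assume "x \<in> R_T UNIV D"
    then obtain \<phi> where \<phi>: "admissible UNIV \<phi>" "\<And>t. x \<in> D (\<phi> t)"
      by (auto simp: R_T_def)
    define b where "b n = \<phi> (replicate n (Suc 0))" for n
    have len: "length (b n) = n" for n
      using admissible_length[OF \<phi>(1)] by (simp add: b_def sum_list_replicate)
    have pre: "prefix (b m) (b n)" if "m \<le> n" for m n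
      unfolding b_def using that
      by (intro admissible_prefix[OF \<phi>(1)])
        (auto simp: prefix_def, metis le_add_diff_inverse replicate_add)
    have "b n = map (\<lambda>i. b (Suc i) ! i) [0..<n]" for n
    proof (rule nth_equalityI)
      fix i assume "i < length (b n)"
      then have "prefix (b (Suc i)) (b n)" using pre len by simp
      then show "b n ! i = map (\<lambda>i. b (Suc i) ! i) [0..<n] ! i"
        using \<open>i < length (b n)\<close> len by (auto simp: prefix_def nth_append)
    qed (simp add: len)
    then have "\<forall>n. x \<in> D (map (\<lambda>i. b (Suc i) ! i) [0..<n])"
      using \<phi>(2) by (metis b_def)
    then show "x \<in> suslin_op D"
      unfolding suslin_op_def by blast
  qed
qed (rule suslin_op_subset_R_T)

lemma R_T_singleton: "R_T {[]} D = D []"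
proof -
  have "admissible {[]} (\<lambda>t. [])" by (auto simp: admissible_def)
  then show ?thesis by (auto simp: R_T_def)
qed

text \<open>Composition with \<open>g\<close> turns an admissible map for \<open>D\<close> into one
  for \<open>E\<close>. This compares schemes whose words are coded differently.\<close>

lemma R_T_mono:
  assumes "\<And>s. D s \<subseteq> E (g s)" "g [] = []"
    and "\<And>s t. prefix s t \<Longrightarrow> prefix (g s) (g t)" "\<And>s. length (g s) = length s"
  shows "R_T T D \<subseteq> R_T T E"
proof
  fix x assume "x \<in> R_T T D"
  then obtain \<phi> where "x \<in> D []" "admissible T \<phi>" "\<forall>t\<in>T. x \<in> D (\<phi> t)"
    by (auto simp: R_T_def)
  moreover from this have "admissible T (g \<circ> \<phi>)"
    using assms by (intro admissible_comp) auto
  ultimately show "x \<in> R_T T E"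
    unfolding R_T_def using assms(1) assms(1)[of "[]"] assms(2)
    by (auto intro!: exI[of _ "g \<circ> \<phi>"] simp del: assms(2)) blast+
qed

text \<open>All values at \<open>n # t\<close> extend \<open>\<phi> [n]\<close>, a word of length
  \<open>n\<close>; removing it leaves an admissible map on the subtree.\<close>

lemma admissible_subtree:
  assumes \<phi>: "admissible S \<phi>" and S: "\<And>t. t \<in> T \<Longrightarrow> n # t \<in> S" and T: "[] \<in> T"
  obtains u \<psi> where "length u = n" "admissible T \<psi>" "\<And>t. t \<in> T \<Longrightarrow> \<phi> (n # t) = u @ \<psi> t"
proof -
  define u where "u = \<phi> [n]"
  have u: "length u = n" using admissible_length[OF \<phi> S[OF T]] by (simp add: u_def)
  have "prefix u (\<phi> (n # t))" if "t \<in> T" for t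
    unfolding u_def using admissible_prefix[OF \<phi> S[OF T] S[OF that]] by simp
  then have eq: "\<phi> (n # t) = u @ drop n (\<phi> (n # t))" if "t \<in> T" for t
    using that u by (metis append_eq_conv_conj prefix_def)
  have "admissible T (\<lambda>t. drop n (\<phi> (n # t)))"
    unfolding admissible_def
  proof (intro conjI ballI impI)
    fix s t assume st: "s \<in> T" "t \<in> T" "prefix s t"
    then have "prefix (\<phi> (n # s)) (\<phi> (n # t))"
      by (intro admissible_prefix[OF \<phi>] S) auto
    then show "prefix (drop n (\<phi> (n # s))) (drop n (\<phi> (n # t)))"
      using eq st by (metis same_prefix_prefix)
  next
    fix t assume "t \<in> T"
    then show "length (drop n (\<phi> (n # t))) = sum_list t"
      using admissible_length[OF \<phi> S] by simp
  qed
  with u eq that show thesis by blast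
qed

text \<open>Subtrees above distinct \<open>n\<close> meet only through the root, so an admissible
  map on \<open>node T\<close> amounts to independent choices of a word \<open>u n\<close> and an
  admissible map \<open>\<psi> n\<close>.\<close>

lemma R_T_node:
  assumes T: "\<And>n. [] \<in> T n"
  shows "R_T (node T) D = (\<Inter>n. \<Union>u\<in>{u. length u = n}. R_T (T n) (\<lambda>s. D (u @ s)))"
    (is "?L = ?R")
proof
  show "?L \<subseteq> ?R"
  proof
    fix x assume "x \<in> ?L"
    then obtain \<phi> where \<phi>: "admissible (node T) \<phi>" "\<And>t. t \<in> node T \<Longrightarrow> x \<in> D (\<phi> t)"
      by (auto simp: R_T_def)
    show "x \<in> ?R"
    proof
      fix n
      obtain u \<psi> where *: "length u = n" "admissible (T n) \<psi>" "\<And>t. t \<in> T n \<Longrightarrow> \<phi> (n # t) = u @ \<psi> t"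
        using admissible_subtree[OF \<phi>(1), of "T n" n] T by auto
      have x: "x \<in> D (u @ \<psi> t)" if "t \<in> T n" for t
        using \<phi>(2)[of "n # t"] *(3) that by simp
      moreover have "\<psi> [] = []" using admissible_length[OF *(2) T] by simp
      ultimately have "x \<in> R_T (T n) (\<lambda>s. D (u @ s))"
        using *(2) x[OF T] by (auto simp: R_T_def)
      then show "x \<in> (\<Union>u\<in>{u. length u = n}. R_T (T n) (\<lambda>s. D (u @ s)))"
        using *(1) by blast
    qed
  qed
  show "?R \<subseteq> ?L"
  proof
    fix x assume "x \<in> ?R"
    then have "\<forall>n. \<exists>u. length u = n \<and> x \<in> R_T (T n) (\<lambda>s. D (u @ s))" by auto
    then obtain u where u: "\<And>n. length (u n) = n" "\<And>n. x \<in> R_T (T n) (\<lambda>s. D (u n @ s))"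
      by metis
    from u(2) have "\<forall>n. \<exists>\<psi>. admissible (T n) \<psi> \<and> (\<forall>t\<in>T n. x \<in> D (u n @ \<psi> t))"
      by (auto simp: R_T_def)
    then obtain \<psi> where \<psi>: "\<And>n. admissible (T n) (\<psi> n)" "\<And>n t. t \<in> T n \<Longrightarrow> x \<in> D (u n @ \<psi> n t)"
      by metis
    define \<phi> where "\<phi> t = (case t of [] \<Rightarrow> [] | n # s \<Rightarrow> u n @ \<psi> n s)" for t
    \<comment> \<open>In slot \<open>0\<close> the word \<open>u 0\<close> is empty, which yields
      membership at the root.\<close>
    have x: "x \<in> D []" using u(1)[of 0] u(2)[of 0] by (auto simp: R_T_def)
    have "admissible (node T) \<phi>"
      unfolding admissible_def
    proof (intro conjI ballI impI)
      fix s t assume "s \<in> node T" "t \<in> node T" "prefix s t"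
      then show "prefix (\<phi> s) (\<phi> t)"
        using \<psi>(1) by (cases s; cases t) (auto simp: \<phi>_def intro: admissible_prefix)
    next
      fix t assume "t \<in> node T"
      then show "length (\<phi> t) = sum_list t"
        using \<psi>(1) u(1) by (cases t) (auto simp: \<phi>_def intro: admissible_length)
    qed
    moreover have "x \<in> D (\<phi> t)" if "t \<in> node T" for t
      using that \<psi>(2) x by (cases t) (auto simp: \<phi>_def)
    ultimately show "x \<in> ?L" using x by (auto simp: R_T_def)
  qed
qed

text \<open>The stem \<open>[1]\<close> costs one letter \<open>m\<close>, hence a single countable
  union. There is no slot \<open>0\<close>, so root membership comes from
  \<open>D s \<subseteq> D []\<close>.\<close>

lemma R_T_odd:
  assumes T: "[] \<in> T" and D: "\<And>s. D s \<subseteq> D []"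
  shows "R_T ({[]} \<union> {1 # s |s. s \<in> T}) D = (\<Union>m. R_T T (\<lambda>s. D (m # s)))" (is "R_T ?S D = _")
proof
  show "R_T ?S D \<subseteq> (\<Union>m. R_T T (\<lambda>s. D (m # s)))"
  proof
    fix x assume "x \<in> R_T ?S D"
    then obtain \<phi> where \<phi>: "admissible ?S \<phi>" "\<And>t. t \<in> ?S \<Longrightarrow> x \<in> D (\<phi> t)"
      unfolding R_T_def by blast
    obtain u \<psi> where *: "length u = 1" "admissible T \<psi>" "\<And>t. t \<in> T \<Longrightarrow> \<phi> (1 # t) = u @ \<psi> t"
      using admissible_subtree[OF \<phi>(1), of T 1] T by auto
    then obtain m where m: "u = [m]" by (auto simp: length_Suc_conv)
    have x: "x \<in> D (m # \<psi> t)" if "t \<in> T" for t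
      using \<phi>(2)[of "1 # t"] *(3) that m by simp
    moreover have "\<psi> [] = []" using admissible_length[OF *(2) T] by simp
    ultimately have "x \<in> R_T T (\<lambda>s. D (m # s))"
      using *(2) x[OF T] by (auto simp: R_T_def)
    then show "x \<in> (\<Union>m. R_T T (\<lambda>s. D (m # s)))" by blast
  qed
  show "(\<Union>m. R_T T (\<lambda>s. D (m # s))) \<subseteq> R_T ?S D"
  proof
    fix x assume "x \<in> (\<Union>m. R_T T (\<lambda>s. D (m # s)))"
    then obtain m \<psi> where m: "x \<in> D [m]" "admissible T \<psi>" "\<And>t. t \<in> T \<Longrightarrow> x \<in> D (m # \<psi> t)"
      by (auto simp: R_T_def)
    define \<phi> where "\<phi> t = (case t of [] \<Rightarrow> [] | n # s \<Rightarrow> m # \<psi> s)" for t :: "nat list"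
    have x: "x \<in> D []" using m(1) D by blast
    have "admissible ?S \<phi>"
      using m(2) by (auto simp: admissible_def \<phi>_def)
    moreover have "\<forall>t\<in>?S. x \<in> D (\<phi> t)" using x m by (auto simp: \<phi>_def)
    ultimately show "x \<in> R_T ?S D" using x unfolding R_T_def by blast
  qed
qed

section \<open>Values of \<open>\<^bold>R\<close> on closed schemes are \<open>\<F>\<close>-Borel\<close>

text \<open>\<open>from_nat_into\<close> enumerates \<open>I\<close>, possibly with repetitions,
  provided that \<open>I\<close> is nonempty.\<close>

lemma Fborel_Union:
  assumes "x < z" "osucc x < w1" "even (fin_of x)" "countable I" "I \<noteq> {}"
    and "\<And>i. i \<in> I \<Longrightarrow> Fborel Y w1 x (A i)"
  shows "Fborel Y w1 (osucc x) (\<Union>i\<in>I. A i)"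
proof -
  have "Fborel Y w1 (osucc x) (\<Union>n. A (from_nat_into I n))"
    using assms from_nat_into[OF assms(5)]
    by (intro Fborel.F_odd[where \<beta> = "\<lambda>_. x"])
      (auto simp: ozero_less_osucc fin_of_osucc less_osucc)
  moreover have "(\<Union>n. A (from_nat_into I n)) = (\<Union>i\<in>I. A i)"
    using range_from_nat_into[OF assms(5,4)] by (metis image_image)
  ultimately show ?thesis by simp
qed

locale omega1_enum = omega1 w1 for w1 :: "'o::wellorder" +
  fixes \<pi> :: "'o \<Rightarrow> nat \<Rightarrow> 'o"
  assumes bij: "\<beta> < w1 \<Longrightarrow> is_limit \<beta> \<Longrightarrow> bij_betw (\<pi> \<beta>) UNIV {\<gamma>. \<gamma> < \<beta>}"

text \<open>The induction varies \<open>C\<close>, since the subtree above \<open>n\<close> sees the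
  shifted schemes \<open>C (u @ s)\<close>. Only countably many words \<open>u\<close> have length
  \<open>n\<close>.\<close>

lemma (in omega1_enum) Fborel_R_T_tree:
  "\<lbrakk>\<alpha> < w1; even (fin_of \<alpha>); \<And>s. closedin Y (C s)\<rbrakk>
    \<Longrightarrow> Fborel Y w1 \<alpha> (R_T (tree w1 \<pi> (oprime \<alpha>)) C)"
proof (induction \<alpha> arbitrary: C rule: less_induct)
  case (less \<alpha>)
  have ctbl: "countable {u :: nat list. length u = n}" "{u :: nat list. length u = n} \<noteq> {}" for n
    using Ex_list_of_length by auto
  show ?case
  using less.prems(2)
  proof (cases \<alpha> rule: even_fin_of_cases)
    case zero
    then show ?thesis
      using less.prems by (simp add: oprime_limit tree_ozero R_T_singleton Fborel.F_zero)
  next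
    case lim
    have node: "tree w1 \<pi> (oprime \<alpha>) = node (\<lambda>n. tree w1 \<pi> (\<pi> \<alpha> n))"
      using lim less.prems by (simp add: oprime_limit tree_limit)
    \<comment> \<open>The subtree has index \<open>\<pi> \<alpha> n\<close>, while the induction
      hypothesis speaks of \<open>oprime x\<close> for an even class \<open>x\<close>.\<close>
    have "\<exists>x. x < \<alpha> \<and> even (fin_of x) \<and> oprime x = \<pi> \<alpha> n" for n
      using even_preimage_oprime[OF lim, of "\<pi> \<alpha> n"] bij_betwE[OF bij[OF less.prems(1) lim]] by auto
    then obtain x where x: "\<And>n. x n < \<alpha>" "\<And>n. even (fin_of (x n))" "\<And>n. oprime (x n) = \<pi> \<alpha> n"
      by metis
    have "Fborel Y w1 (osucc (x n)) (\<Union>u\<in>{u. length u = n}. R_T (tree w1 \<pi> (\<pi> \<alpha> n)) (\<lambda>s. C (u @ s)))" for n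
      using x[of n] less.prems osucc_less_limit[OF lim x(1), of n] less.IH[OF x(1), of n]
      by (intro Fborel_Union[OF x(1) _ _ ctbl]) auto
    then show ?thesis
      unfolding node R_T_node[OF Nil_in_tree] using less.prems lim osucc_less_limit[OF lim x(1)]
      by (intro Fborel.F_even[where \<beta> = "\<lambda>n. osucc (x n)"]) (auto simp: is_limit_def)
  next
    case (succ y)
    have y: "y < \<alpha>" "y < w1" "osucc y < w1" "oprime y < w1"
      using succ(1,2) less.prems(1) oprime_le[of y] by auto
    have node: "tree w1 \<pi> (oprime \<alpha>) = node (\<lambda>n. tree w1 \<pi> (oprime y))"
      unfolding succ(5) using y(4) by (intro tree_osucc osucc_less_limit[OF is_limit_w1])
    have "Fborel Y w1 (osucc y) (\<Union>u\<in>{u. length u = n}. R_T (tree w1 \<pi> (oprime y)) (\<lambda>s. C (u @ s)))" for n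
      using y less.prems succ less.IH[OF y(1)]
      by (intro Fborel_Union[OF y(2) y(3) _ ctbl]) auto
    then show ?thesis
      unfolding node R_T_node[OF Nil_in_tree] using less.prems succ
      by (intro Fborel.F_even[where \<beta> = "\<lambda>n. osucc y"]) (auto simp: le_less_trans[OF ozero_le])
  qed
qed

section \<open>\<open>\<F>\<close>-Borel sets are values of \<open>\<^bold>R\<close>\<close>

lemma Fborel_subset: "Fborel Y w1 x A \<Longrightarrow> A \<subseteq> topspace Y"
proof (induction rule: Fborel.induct)
  case (F_omega1 A)
  then show ?case by (fastforce simp: suslinF_def dest: closedin_subset)
qed (auto dest: closedin_subset)

text \<open>A constant sequence raises the class, whether \<open>x\<close> calls for unions or for
  intersections.\<close>

lemma Fborel_mono:
  assumes "Fborel Y w1 y A" "y \<le> x" "x < w1"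
  shows "Fborel Y w1 x A"
proof (cases "y = x")
  case False
  with assms have "y < x" by simp
  moreover from this have "ozero < x" by (rule le_less_trans[OF ozero_le])
  ultimately show ?thesis
    using assms Fborel.F_odd[where \<beta> = "\<lambda>_. y" and A = "\<lambda>_. A" and \<alpha> = x]
      Fborel.F_even[where \<beta> = "\<lambda>_. y" and A = "\<lambda>_. A" and \<alpha> = x]
    by (cases "even (fin_of x)") auto
qed (use assms in simp)

lemma Fborel_oddE:
  assumes "Fborel Y w1 x X" "odd (fin_of x)" "x < w1"
  obtains y A where "\<And>n::nat. y n < x" "\<And>n. Fborel Y w1 (y n) (A n)" "X = (\<Union>n. A n)"
  using assms(1)
proof cases
  case (F_odd \<beta> A)
  then show thesis by (intro that[of \<beta> A]) auto
qed (use assms in \<open>auto simp: fin_of_limit\<close>)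

lemma Fborel_evenE:
  assumes "Fborel Y w1 x X" "even (fin_of x)" "ozero < x" "x < w1"
  obtains y A where "\<And>n::nat. y n < x" "\<And>n. Fborel Y w1 (y n) (A n)" "X = (\<Inter>n. A n)"
  using assms(1)
proof cases
  case (F_even \<beta> A)
  then show thesis by (intro that[of \<beta> A]) auto
qed (use assms in \<open>auto simp: fin_of_limit\<close>)

text \<open>The induction invariant: \<open>X = suslin_op C\<close> provides branches that can be
  merged into branches of a new scheme, and \<open>X = R_T T C\<close> bounds the new
  \<open>R_T\<close> from above.\<close>

definition closed_rep :: "'a topology \<Rightarrow> nat list set \<Rightarrow> 'a set \<Rightarrow> (nat list \<Rightarrow> 'a set) \<Rightarrow> bool" where
  "closed_rep Y T X C \<longleftrightarrow> suslin_scheme (topspace Y) C \<and> (\<forall>s. closedin Y (C s)) \<and>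
     X = suslin_op C \<and> X = R_T T C"

text \<open>The chain \<open>X \<subseteq> suslin_op C \<subseteq> R_T T C \<subseteq> X\<close> is
  closed by \<open>suslin_op_subset_R_T\<close>.\<close>

lemma closed_repI:
  assumes "\<And>s. closedin Y (C s)" "\<And>s t. prefix s t \<Longrightarrow> C t \<subseteq> C s"
    and "X \<subseteq> suslin_op C" "R_T T C \<subseteq> X"
  shows "closed_rep Y T X C"
  using assms closedin_subset[OF assms(1)] suslin_op_subset_R_T[of C T]
  unfolding closed_rep_def suslin_scheme_def by blast

lemma closed_rep_closed:
  assumes "closedin Y X"
  shows "closed_rep Y T X (\<lambda>s. X)"
  using assms by (intro closed_repI) (auto simp: suslin_op_def R_T_def)

lemma closed_rep_suslinF:
  fixes Y :: "'a topology"
  assumes "suslinF Y X"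
  shows "\<exists>C. closed_rep Y UNIV X C"
proof -
  obtain F :: "nat list \<Rightarrow> 'a set"
    where "(\<forall>s. closedin Y (F s)) \<and> X = (\<Union>\<sigma>. \<Inter>k. F (map \<sigma> [0..<Suc k]))"
    using assms unfolding suslinF_def by (rule exE)
  then have F: "closedin Y (F s)" "X = (\<Union>\<sigma>. \<Inter>k. F (map \<sigma> [0..<Suc k]))" for s
    by simp_all
  \<comment> \<open>Intersecting over initial segments makes the scheme decreasing; at the empty
    word only \<open>topspace Y\<close> remains.\<close>
  define C where "C s = topspace Y \<inter> (\<Inter>k\<in>{..<length s}. F (take (Suc k) s))" for s
  have "closedin Y (C s)" for s
    unfolding C_def using F(1)
    by (cases "length s") (auto intro!: closedin_Int closedin_INT)
  moreover have "C t \<subseteq> C s" if "prefix s t" for s t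
  proof -
    obtain r where t: "t = s @ r" using \<open>prefix s t\<close> by (auto simp: prefix_def)
    then have "take (Suc k) t = take (Suc k) s" if "k < length s" for k
      using that by simp
    then show ?thesis
      unfolding C_def using t by (intro Int_mono INT_anti_mono) auto
  qed
  moreover have "suslin_op C = X"
  proof -
    have take: "take (Suc k) (map \<sigma> [0..<n]) = map \<sigma> [0..<Suc k]" if "k < n" for k n and \<sigma> :: "nat \<Rightarrow> nat"
      using that by (simp add: take_map)
    have "(\<Inter>n. C (map \<sigma> [0..<n])) = (\<Inter>k. F (map \<sigma> [0..<Suc k]))" for \<sigma>
    proof
      have "C (map \<sigma> [0..<Suc k]) \<subseteq> F (map \<sigma> [0..<Suc k])" for k
        using take[of k "Suc k" \<sigma>] by (auto simp: C_def simp del: upt_Suc)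
      then show "(\<Inter>n. C (map \<sigma> [0..<n])) \<subseteq> (\<Inter>k. F (map \<sigma> [0..<Suc k]))" by blast
      show "(\<Inter>k. F (map \<sigma> [0..<Suc k])) \<subseteq> (\<Inter>n. C (map \<sigma> [0..<n]))"
        using closedin_subset[OF F(1)] take by (fastforce simp: C_def simp del: upt_Suc)
    qed
    then show ?thesis by (simp add: suslin_op_def F(2) del: upt_Suc)
  qed
  ultimately have "closed_rep Y UNIV X C"
    by (intro closed_repI) (auto simp: R_T_UNIV)
  then show ?thesis by blast
qed

text \<open>The first letter selects \<open>m\<close>, and the remaining letters drive
  \<open>C m\<close>.\<close>

lemma closed_rep_odd:
  fixes C :: "nat \<Rightarrow> nat list \<Rightarrow> 'a set"
  assumes "[] \<in> T" "\<And>m. closed_rep Y T (Z m) (C m)"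
  shows "\<exists>D. closed_rep Y ({[]} \<union> {1 # s |s. s \<in> T}) (\<Union>m. Z m) D"
proof -
  define D where "D s = (case s of [] \<Rightarrow> topspace Y | m # t \<Rightarrow> C m t)" for s
  have C: "closedin Y (C m s)" "C m s \<subseteq> topspace Y" "prefix s t \<Longrightarrow> C m t \<subseteq> C m s"
    "Z m = suslin_op (C m)" "Z m = R_T T (C m)" for m s t
    using assms(2)[of m] by (auto simp: closed_rep_def suslin_scheme_def)
  have "closed_rep Y ({[]} \<union> {1 # s |s. s \<in> T}) (\<Union>m. Z m) D"
  proof (rule closed_repI)
    show "closedin Y (D s)" for s
      using C(1) by (auto simp: D_def split: list.split)
    show "D t \<subseteq> D s" if "prefix s t" for s t
      using that C(2) C(3) by (cases s; cases t) (simp_all add: D_def)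
    show "(\<Union>m. Z m) \<subseteq> suslin_op D"
    proof
      fix x assume "x \<in> (\<Union>m. Z m)"
      then obtain m \<sigma> where x: "\<And>n. x \<in> C m (map \<sigma> [0..<n])"
        unfolding C(4) suslin_op_def by blast
      have "x \<in> D (map (case_nat m \<sigma>) [0..<n])" for n
      proof (cases n)
        case (Suc k)
        have "map (case_nat m \<sigma>) [0..<Suc k] = m # map \<sigma> [0..<k]"
          by (simp add: upt_conv_Cons map_Suc_upt[symmetric] del: upt_Suc map_Suc_upt)
        with Suc x show ?thesis by (simp add: D_def del: upt_Suc)
      qed (use x[of 0] C(2) in \<open>auto simp: D_def\<close>)
      then show "x \<in> suslin_op D" unfolding suslin_op_def by blast
    qed
    have "D s \<subseteq> D []" for s using C(2) by (auto simp: D_def split: list.split)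
    then show "R_T ({[]} \<union> {1 # s |s. s \<in> T}) D \<subseteq> (\<Union>m. Z m)"
      using assms(1) by (subst R_T_odd) (auto simp: D_def C(5))
  qed
  then show ?thesis by blast
qed

text \<open>One letter has to carry a finite list of choices whose length grows with the position;
  only the first \<open>k\<close> coordinates are prescribed.\<close>

lemma list_decode_coordinates: "\<exists>a. \<forall>i<k. list_decode a ! i = f i"
  by (rule exI[of _ "list_encode (map f [0..<k])"]) simp

text \<open>The entry at position \<open>j\<close> of a sequence encodes the choice of \<open>m\<close> for \<open>n = j\<close>
  together with the entry at position \<open>j - Suc i\<close> of the sequence fed to the scheme
  \<open>C i m\<close>, for every \<open>i < j\<close>. This delay by \<open>Suc i\<close> matches the fact that admissible
  maps have length \<open>Suc i + |t|\<close> at \<open>Suc i # t\<close>.\<close>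

lemma closed_rep_node:
  fixes C :: "nat \<Rightarrow> nat \<Rightarrow> nat list \<Rightarrow> 'a set"
  assumes T: "\<And>n. [] \<in> T n" and rep: "\<And>n m. closed_rep Y (T (Suc n)) (Z n m) (C n m)"
  shows "\<exists>D. closed_rep Y (node T) (\<Inter>n. \<Union>m. Z n m) D"
proof -
  define c where "c a i = list_decode a ! i" for a i
  define D where "D s = topspace Y \<inter> (\<Inter>i\<in>{..<length s}.
    C i (c (s ! i) 0) (map (\<lambda>j. c (s ! j) (Suc i)) [Suc i..<length s]))" for s
  have C: "closedin Y (C n m s)" "C n m s \<subseteq> topspace Y" "prefix s t \<Longrightarrow> C n m t \<subseteq> C n m s"
    "Z n m = suslin_op (C n m)" "Z n m = R_T (T (Suc n)) (C n m)" for n m s t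
    using rep[of n m] by (auto simp: closed_rep_def suslin_scheme_def)
  have "closed_rep Y (node T) (\<Inter>n. \<Union>m. Z n m) D"
  proof (rule closed_repI)
    show "closedin Y (D s)" for s
      unfolding D_def using C(1) by (cases "length s") (auto intro!: closedin_Int closedin_INT simp del: upt_Suc)
    show "D t \<subseteq> D s" if "prefix s t" for s t
    proof -
      obtain r where t: "t = s @ r" using \<open>prefix s t\<close> by (auto simp: prefix_def)
      have "C i (c (t ! i) 0) (map (\<lambda>j. c (t ! j) (Suc i)) [Suc i..<length t])
          \<subseteq> C i (c (s ! i) 0) (map (\<lambda>j. c (s ! j) (Suc i)) [Suc i..<length s])"
        if "i < length s" for i
      proof -
        have "[Suc i..<length t] = [Suc i..<length s] @ [length s..<length t]"
          using that t upt_add_eq_append[of "Suc i" "length s" "length r"] by simp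
        moreover have "map (\<lambda>j. c (t ! j) (Suc i)) [Suc i..<length s] = map (\<lambda>j. c (s ! j) (Suc i)) [Suc i..<length s]"
          by (simp add: t nth_append)
        ultimately have "prefix (map (\<lambda>j. c (s ! j) (Suc i)) [Suc i..<length s]) (map (\<lambda>j. c (t ! j) (Suc i)) [Suc i..<length t])"
          by (metis map_append prefixI)
        then show ?thesis using C(3) that t by (simp add: nth_append)
      qed
      then show ?thesis unfolding D_def t by fastforce
    qed
    show "(\<Inter>n. \<Union>m. Z n m) \<subseteq> suslin_op D"
    proof
      fix x assume "x \<in> (\<Inter>n. \<Union>m. Z n m)"
      then have "\<forall>n. \<exists>m \<tau>. \<forall>k. x \<in> C n m (map \<tau> [0..<k])"
        by (simp add: C(4) suslin_op_def)
      then obtain m \<tau> where x: "\<And>n k. x \<in> C n (m n) (map (\<tau> n) [0..<k])"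
        by metis
      have "\<exists>a. \<forall>i<Suc j. c a i = case_nat (m j) (\<lambda>i. \<tau> i (j - Suc i)) i" for j
        unfolding c_def by (rule list_decode_coordinates)
      then obtain \<sigma> where \<sigma>: "\<And>j i. i < Suc j \<Longrightarrow> c (\<sigma> j) i = case_nat (m j) (\<lambda>i. \<tau> i (j - Suc i)) i"
        by metis
      have "x \<in> D (map \<sigma> [0..<n])" for n
      proof -
        have "x \<in> C i (c (map \<sigma> [0..<n] ! i) 0) (map (\<lambda>j. c (map \<sigma> [0..<n] ! j) (Suc i)) [Suc i..<n])"
          if "i < n" for i
        proof -
          have "map (\<lambda>j. c (map \<sigma> [0..<n] ! j) (Suc i)) [Suc i..<n] = map (\<tau> i) [0..<n - Suc i]"
            by (rule nth_equalityI) (auto simp: \<sigma>)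
          moreover have "c (map \<sigma> [0..<n] ! i) 0 = m i" using that by (simp add: \<sigma>)
          ultimately show ?thesis using x by simp
        qed
        moreover have "x \<in> topspace Y" using x C(2) by blast
        ultimately show ?thesis by (auto simp: D_def)
      qed
      then show "x \<in> suslin_op D" unfolding suslin_op_def by blast
    qed
    show "R_T (node T) D \<subseteq> (\<Inter>n. \<Union>m. Z n m)"
    proof
      fix x assume "x \<in> R_T (node T) D"
      then have x: "x \<in> (\<Inter>n. \<Union>u\<in>{u. length u = n}. R_T (T n) (\<lambda>s. D (u @ s)))"
        by (simp only: R_T_node[OF T])
      show "x \<in> (\<Inter>n. \<Union>m. Z n m)"
      proof
        fix n
        \<comment> \<open>The subtree above \<open>Suc n\<close> is taken, not the one above
          \<open>n\<close>: a word of length \<open>Suc n\<close> already has the letter at position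
          \<open>n\<close>, which determines \<open>m\<close>.\<close>
        obtain u where u: "length u = Suc n" "x \<in> R_T (T (Suc n)) (\<lambda>s. D (u @ s))"
          using x by blast
        \<comment> \<open>After \<open>u\<close>, each further letter contributes its coordinate
          \<open>Suc n\<close> to the word read by \<open>C n m\<close>, so lengths agree.\<close>
        have "D (u @ s) \<subseteq> C n (c (u ! n) 0) (map (\<lambda>a. c a (Suc n)) s)" for s
        proof -
          have "map (\<lambda>j. c ((u @ s) ! j) (Suc n)) [Suc n..<length (u @ s)] = map (\<lambda>a. c a (Suc n)) s"
            by (rule nth_equalityI) (auto simp: u nth_append simp del: upt_Suc)
          moreover have "(u @ s) ! n = u ! n" using u by (simp add: nth_append)
          ultimately have "C n (c ((u @ s) ! n) 0) (map (\<lambda>j. c ((u @ s) ! j) (Suc n)) [Suc n..<length (u @ s)])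
              = C n (c (u ! n) 0) (map (\<lambda>a. c a (Suc n)) s)" by simp
          moreover have "n < length (u @ s)" using u by simp
          ultimately show ?thesis unfolding D_def by blast
        qed
        then have "R_T (T (Suc n)) (\<lambda>s. D (u @ s)) \<subseteq> R_T (T (Suc n)) (C n (c (u ! n) 0))"
          by (rule R_T_mono) (auto intro: map_mono_prefix)
        then show "x \<in> (\<Union>m. Z n m)" using u(2) C(5) by blast
      qed
    qed
  qed
  then show ?thesis by blast
qed

text \<open>Each value is chosen in \<open>S k\<close> above the previous one. Strictness keeps the
  slots assigned at a limit stage distinct.\<close>

lemma strict_mono_choice:
  assumes "\<And>k::nat. infinite (S k :: nat set)"
  obtains g where "strict_mono g" "\<And>k. g k \<in> S k"
proof -
  have "\<exists>g. \<forall>k. g k \<in> S k \<and> g k < g (Suc k)"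
  proof (rule dependent_nat_choice)
    show "\<exists>x. x \<in> S 0" using assms[of 0] by (metis equals0I finite.emptyI)
    show "\<exists>y. y \<in> S (Suc n) \<and> x < y" for x n
      using assms[of "Suc n"] unfolding infinite_nat_iff_unbounded by blast
  qed
  then show thesis using that by (metis strict_mono_Suc_iff)
qed

text \<open>At a limit each factor \<open>A k\<close> gets a slot with a large enough subtree; at a
  double successor each factor is a countable union of sets of class \<open>y\<close>.\<close>

lemma (in omega1_enum) Fborel_closed_rep:
  "\<lbrakk>\<alpha> < w1; even (fin_of \<alpha>); Fborel Y w1 \<alpha> X\<rbrakk>
    \<Longrightarrow> \<exists>C. closed_rep Y (tree w1 \<pi> (oprime \<alpha>)) X C"
proof (induction \<alpha> arbitrary: X rule: less_induct)
  case (less \<alpha>)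
  show ?case
  using less.prems(2)
  proof (cases \<alpha> rule: even_fin_of_cases)
    case zero
    have "closedin Y X"
      using less.prems(3,1) zero by cases auto
    then show ?thesis using closed_rep_closed by blast
  next
    case lim
    then have "ozero < \<alpha>" by (simp add: is_limit_def)
    with less.prems obtain b A where A: "\<And>n::nat. b n < \<alpha>" "\<And>n. Fborel Y w1 (b n) (A n)" "X = (\<Inter>n. A n)"
      by (metis Fborel_evenE)
    note bij = bij[OF less.prems(1) lim]
    \<comment> \<open>\<open>\<pi> \<alpha>\<close> exhausts the infinite interval from
      \<open>b k\<close> up to \<open>\<alpha>\<close>. Slot \<open>0\<close> is left out because
      \<open>closed_rep_node\<close> places its sets only above \<open>Suc n\<close>.\<close>
    have "infinite {n. b k \<le> \<pi> \<alpha> (Suc n)}" for k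
    proof
      assume "finite {n. b k \<le> \<pi> \<alpha> (Suc n)}"
      moreover have "{d. b k \<le> d \<and> d < \<alpha>} \<subseteq> insert (\<pi> \<alpha> 0) ((\<lambda>n. \<pi> \<alpha> (Suc n)) ` {n. b k \<le> \<pi> \<alpha> (Suc n)})"
      proof
        fix d assume d: "d \<in> {d. b k \<le> d \<and> d < \<alpha>}"
        then obtain n where "d = \<pi> \<alpha> n" using bij by (auto simp: bij_betw_def)
        then show "d \<in> insert (\<pi> \<alpha> 0) ((\<lambda>n. \<pi> \<alpha> (Suc n)) ` {n. b k \<le> \<pi> \<alpha> (Suc n)})"
          using d by (cases n) auto
      qed
      ultimately show False
        using infinite_above_limit[OF lim A(1)] by (meson finite.insertI finite_imageI finite_subset)
    qed
    then obtain g where "strict_mono g" "\<And>k. g k \<in> {n. b k \<le> \<pi> \<alpha> (Suc n)}"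
      using strict_mono_choice[of "\<lambda>k. {n. b k \<le> \<pi> \<alpha> (Suc n)}"] by metis
    then have g: "strict_mono g" "\<And>k. b k \<le> \<pi> \<alpha> (Suc (g k))" by auto
    have inj: "inj g" using g(1) by (rule strict_mono_imp_inj_on)
    have "\<exists>x. \<pi> \<alpha> (Suc n) \<le> x \<and> x < \<alpha> \<and> even (fin_of x) \<and> oprime x = \<pi> \<alpha> (Suc n)" for n
      using even_preimage_oprime[OF lim] bij_betwE[OF bij] by auto
    then obtain x where x: "\<And>n. \<pi> \<alpha> (Suc n) \<le> x n" "\<And>n. x n < \<alpha>" "\<And>n. even (fin_of (x n))"
        "\<And>n. oprime (x n) = \<pi> \<alpha> (Suc n)"
      by metis
    \<comment> \<open>\<open>A k\<close> occupies the slot \<open>g k\<close>, whose tree is large enough for it;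
      the remaining slots carry the whole space.\<close>
    define Z where "Z n = (if n \<in> range g then A (inv g n) else topspace Y)" for n
    have "\<exists>C. closed_rep Y (tree w1 \<pi> (\<pi> \<alpha> (Suc n))) (Z n) C" for n
    proof (cases "n \<in> range g")
      case True
      then obtain k where k: "n = g k" by blast
      have "Fborel Y w1 (x n) (A k)"
        using A(2)[of k] g(2)[of k] x(1,2)[of n] less.prems(1) k
        by (meson Fborel_mono less_trans order_trans)
      then show ?thesis
        using less.IH[OF x(2), of n "A k"] x[of n] less.prems(1) k inj by (simp add: Z_def)
    next
      case False
      then show ?thesis using closed_rep_closed[OF closedin_topspace] by (auto simp: Z_def)
    qed
    then obtain C where "\<And>n. closed_rep Y (tree w1 \<pi> (\<pi> \<alpha> (Suc n))) (Z n) (C n)" by metis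
    \<comment> \<open>The unions over \<open>m\<close> are taken of constant families, since each
      slot holds a single set.\<close>
    then have "\<exists>D. closed_rep Y (node (\<lambda>n. tree w1 \<pi> (\<pi> \<alpha> n))) (\<Inter>n. \<Union>m::nat. Z n) D"
      by (intro closed_rep_node[where C = "\<lambda>n m. C n"]) auto
    moreover have "(\<Inter>n. \<Union>m::nat. Z n) = X"
    proof -
      have "Z (g k) = A k" for k using inj by (simp add: Z_def)
      then have "(\<Inter>n. Z n) \<subseteq> X" unfolding A(3) by blast
      moreover have "X \<subseteq> Z n" for n
        using A(3) Fborel_subset[OF less.prems(3)] by (auto simp: Z_def)
      ultimately show ?thesis by auto
    qed
    ultimately show ?thesis
      using lim less.prems(1) by (simp add: oprime_limit tree_limit)
  next
    case (succ y)
    have y: "y < \<alpha>" "y < w1" "osucc y < w1" "oprime y < w1"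
      using succ(1,2) less.prems(1) oprime_le[of y] by auto
    have node: "tree w1 \<pi> (oprime \<alpha>) = node (\<lambda>n. tree w1 \<pi> (oprime y))"
      unfolding succ(5) using y(4) by (intro tree_osucc osucc_less_limit[OF is_limit_w1])
    have "ozero < \<alpha>" using y(1) by (rule le_less_trans[OF ozero_le])
    with less.prems obtain b A where A: "\<And>n::nat. b n < \<alpha>" "\<And>n. Fborel Y w1 (b n) (A n)" "X = (\<Inter>n. A n)"
      by (metis Fborel_evenE)
    have "\<exists>B. (\<forall>m::nat. Fborel Y w1 y (B m)) \<and> A n = (\<Union>m. B m)" for n
    proof -
      \<comment> \<open>As \<open>\<alpha>\<close> is \<open>y + 2\<close>, the set
        \<open>A n\<close> can be raised to the odd class \<open>y + 1\<close> and then split into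
        sets of class \<open>y\<close>.\<close>
      have "b n \<le> osucc y" using A(1)[of n] succ(3) less_osucc_iff[OF succ(2)] by simp
      then have "Fborel Y w1 (osucc y) (A n)" by (rule Fborel_mono[OF A(2) _ y(3)])
      moreover have "odd (fin_of (osucc y))" using succ(4) fin_of_osucc[OF y(2)] by simp
      ultimately obtain b' B where B: "\<And>m::nat. b' m < osucc y" "\<And>m. Fborel Y w1 (b' m) (B m)" "A n = (\<Union>m. B m)"
        using y(3) by (metis Fborel_oddE)
      have "Fborel Y w1 y (B m)" for m
        using B(1,2)[of m] less_osucc_iff[OF y(2)] y(2) by (auto intro: Fborel_mono)
      with B(3) show ?thesis by blast
    qed
    then obtain B where B: "\<And>n m::nat. Fborel Y w1 y (B n m)" "\<And>n. A n = (\<Union>m. B n m)" by metis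
    have "\<exists>C. closed_rep Y (tree w1 \<pi> (oprime y)) (B n m) C" for n m
      using less.IH[OF y(1,2) succ(4) B(1)] .
    then obtain C where "\<And>n m. closed_rep Y (tree w1 \<pi> (oprime y)) (B n m) (C n m)" by metis
    then have "\<exists>D. closed_rep Y (node (\<lambda>n. tree w1 \<pi> (oprime y))) (\<Inter>n. \<Union>m. B n m) D"
      by (intro closed_rep_node) auto
    then show ?thesis by (simp add: node A(3) B(2))
  qed
qed

section \<open>Complete Suslin schemes\<close>

text \<open>Fixing one branch \<open>\<sigma> x\<close> through every point makes the sets of each level pairwise
  disjoint, so that a filter containing one set of each level follows a single branch.\<close>

lemma K_analytic_complete_scheme:
  fixes K :: "'k topology"
  assumes "K_analytic_via K e X"
  shows "\<exists>D. complete_on X D"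
proof -
  let ?X = "topspace X"
  have K: "compact_space K" and hom: "homeomorphic_map X (subtopology K (e ` ?X)) e"
    and sus: "suslinF K (e ` ?X)"
    using assms by (auto simp: K_analytic_via_def)
  obtain F :: "nat list \<Rightarrow> 'k set"
    where "(\<forall>s. closedin K (F s)) \<and> e ` ?X = (\<Union>\<sigma>. \<Inter>k. F (map \<sigma> [0..<Suc k]))"
    using sus unfolding suslinF_def by (rule exE)
  then have F: "closedin K (F s)" "e ` ?X = (\<Union>\<sigma>. \<Inter>k. F (map \<sigma> [0..<Suc k]))" for s
    by simp_all
  have "\<forall>x\<in>?X. \<exists>\<sigma>. \<forall>k. e x \<in> F (map \<sigma> [0..<Suc k])"
  proof
    fix x assume "x \<in> ?X"
    then have "e x \<in> e ` ?X" by simp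
    then show "\<exists>\<sigma>. \<forall>k. e x \<in> F (map \<sigma> [0..<Suc k])"
      unfolding F(2) by (simp del: upt_Suc)
  qed
  then obtain \<sigma> where \<sigma>: "\<And>x k. x \<in> ?X \<Longrightarrow> e x \<in> F (map (\<sigma> x) [0..<Suc k])"
    unfolding bchoice_iff by blast
  define D where "D s = {x \<in> ?X. map (\<sigma> x) [0..<length s] = s}" for s
  have "complete_on X D"
    unfolding complete_on_def
  proof (intro conjI allI impI)
    have "map f [0..<length s] = s" if "prefix s t" "map f [0..<length t] = t" for f :: "nat \<Rightarrow> nat" and s t
    proof -
      obtain r where t: "t = s @ r" using \<open>prefix s t\<close> by (auto simp: prefix_def)
      have "map f [0..<length s] = take (length s) (map f [0..<length t])"
        by (simp add: take_map t)
      also have "\<dots> = s" using that(2) by (simp add: t)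
      finally show ?thesis .
    qed
    then show "suslin_scheme ?X D"
      unfolding suslin_scheme_def D_def by blast
    have "?X \<subseteq> suslin_op D"
      by (auto simp: suslin_op_def D_def)
    moreover have "suslin_op D \<subseteq> ?X"
      by (auto simp: suslin_op_def D_def)
    ultimately show "suslin_op D = ?X" by blast
  next
    fix G assume "G \<noteq> bot \<and> eventually (\<lambda>x. x \<in> ?X) G \<and>
      (\<forall>n. \<exists>s. length s = n \<and> eventually (\<lambda>x. x \<in> D s) G)"
    then have G: "G \<noteq> bot" "eventually (\<lambda>x. x \<in> ?X) G"
      and "\<forall>n. \<exists>s. length s = n \<and> eventually (\<lambda>x. x \<in> D s) G" by auto
    then obtain s where s: "\<And>n. length (s n) = n" "\<And>n. eventually (\<lambda>x. x \<in> D (s n)) G"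
      by metis
    define \<tau> where "\<tau> n = s (Suc n) ! n" for n
    have s_eq: "s n = map \<tau> [0..<n]" for n
    proof (rule nth_equalityI)
      fix i assume "i < length (s n)"
      then have "i < n" using s(1) by simp
      \<comment> \<open>Two members of a proper filter meet; at a common point both words are
        initial segments of the same \<open>\<sigma> x\<close>.\<close>
      have "eventually (\<lambda>x. x \<in> D (s n) \<and> x \<in> D (s (Suc i))) G"
        using s(2) by (intro eventually_conj)
      then obtain x where "x \<in> D (s n)" "x \<in> D (s (Suc i))"
        using G(1) eventually_happens' by blast
      then have "map (\<sigma> x) [0..<n] = s n" "map (\<sigma> x) [0..<Suc i] = s (Suc i)"
        using s(1) by (auto simp: D_def simp del: upt_Suc)
      then have "s n ! i = \<sigma> x i" "s (Suc i) ! i = \<sigma> x i"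
        using \<open>i < n\<close> by (metis add_0 diff_zero length_upt nth_map nth_upt lessI)+
      then show "s n ! i = map \<tau> [0..<n] ! i" using \<open>i < n\<close> by (simp add: \<tau>_def)
    qed (simp add: s)
    \<comment> \<open>Compactness, through the finite intersection property, gives a cluster point
      \<open>k\<close> in \<open>K\<close> of the image of the filter.\<close>
    let ?\<U> = "{K closure_of (e ` A) |A. A \<subseteq> ?X \<and> eventually (\<lambda>x. x \<in> A) G}"
    have "\<Inter>?\<U> \<noteq> {}"
    proof -
      have fip: "\<Inter>\<F> \<noteq> {}" if "finite \<F>" "\<F> \<subseteq> ?\<U>" for \<F>
      proof -
        have "\<forall>B\<in>\<F>. eventually (\<lambda>x. x \<in> ?X \<and> e x \<in> B) G"
        proof
          fix B assume "B \<in> \<F>"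
          with that(2) have "B \<in> ?\<U>" by blast
          then obtain A where A: "A \<subseteq> ?X" "eventually (\<lambda>x. x \<in> A) G" "B = K closure_of (e ` A)"
            by blast
          have "e ` A \<subseteq> topspace K"
            using A(1) homeomorphic_imp_surjective_map[OF hom] by (auto simp: topspace_subtopology)
          then have "e ` A \<subseteq> B" using A(3) closure_of_subset by metis
          then show "eventually (\<lambda>x. x \<in> ?X \<and> e x \<in> B) G"
            using A(1) by (intro eventually_mono[OF A(2)]) auto
        qed
        then have "eventually (\<lambda>x. \<forall>B\<in>\<F>. x \<in> ?X \<and> e x \<in> B) G"
          using \<open>finite \<F>\<close> by (simp add: eventually_ball_finite)
        then obtain x where "\<forall>B\<in>\<F>. x \<in> ?X \<and> e x \<in> B"
          using G(1) eventually_happens' by blast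
        then show ?thesis by blast
      qed
      have "\<forall>B\<in>?\<U>. closedin K B" by auto
      then show ?thesis
        using K fip unfolding compact_space_fip by blast
    qed
    then obtain k where k: "\<And>A. A \<subseteq> ?X \<Longrightarrow> eventually (\<lambda>x. x \<in> A) G \<Longrightarrow> k \<in> K closure_of (e ` A)"
      by blast
    \<comment> \<open>The closed sets along the branch \<open>\<tau>\<close> all contain
      \<open>k\<close>, which places \<open>k\<close> in the image of \<open>X\<close>.\<close>
    have "k \<in> F (map \<tau> [0..<Suc n])" for n
    proof -
      have "e ` D (s (Suc n)) \<subseteq> F (s (Suc n))"
      proof (rule image_subsetI)
        fix y assume "y \<in> D (s (Suc n))"
        then have "y \<in> ?X" "map (\<sigma> y) [0..<Suc n] = s (Suc n)"
          using s(1) by (auto simp: D_def simp del: upt_Suc)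
        then show "e y \<in> F (s (Suc n))" using \<sigma>[of y n] by metis
      qed
      then have "K closure_of (e ` D (s (Suc n))) \<subseteq> F (s (Suc n))"
        using F(1) by (rule closure_of_minimal)
      moreover have "D (s (Suc n)) \<subseteq> ?X" by (auto simp: D_def)
      ultimately show ?thesis using k s(2)[of "Suc n"] s_eq[of "Suc n"] by auto
    qed
    then have "k \<in> e ` ?X" unfolding F(2) by (intro UN_I[of \<tau>]) auto
    then obtain x where x: "x \<in> ?X" "k = e x" by blast
    \<comment> \<open>Closures relative to the image are carried back to \<open>X\<close> by the
      homeomorphism \<open>e\<close>.\<close>
    have "x \<in> X closure_of A" if "eventually (\<lambda>x. x \<in> A) G" for A
    proof -
      let ?A = "?X \<inter> A"
      have "eventually (\<lambda>x. x \<in> ?A) G" using eventually_conj[OF G(2) that] by simp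
      then have "e x \<in> subtopology K (e ` ?X) closure_of (e ` ?A)"
        using k[of ?A] x by (auto simp: closure_of_subtopology Int_absorb1 image_mono)
      also have "\<dots> = e ` (X closure_of ?A)"
        using hom by (intro homeomorphic_map_closure_of) auto
      finally obtain z where z: "z \<in> X closure_of ?A" "e x = e z" by blast
      moreover have "z \<in> ?X" using z(1) closure_of_subset_topspace[of X ?A] by blast
      ultimately have "x = z"
        using homeomorphic_imp_injective_map[OF hom] x(1) by (auto dest: inj_onD)
      then show ?thesis using z(1) closure_of_mono[of ?A A X] by blast
    qed
    then show "\<exists>x\<in>?X. \<forall>A. eventually (\<lambda>x. x \<in> A) G \<longrightarrow> x \<in> X closure_of A" using x(1) by blast
  qed
  then show ?thesis by blast
qed

text \<open>Letters code pairs, so \<open>E\<close> follows \<open>C\<close> and \<open>D\<close>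
  simultaneously. Completeness passes from \<open>D\<close> to its refinement \<open>E\<close>, and
  the closed sets of \<open>C\<close> still contain the closures of those of
  \<open>E\<close>.\<close>

lemma closed_rep_complete_scheme:
  assumes rep: "closed_rep Y T X C" and D: "complete_on (subtopology Y X) D"
  shows "\<exists>E. complete_on (subtopology Y X) E \<and> X = R_T T (closure_scheme Y E)"
proof -
  let ?f = "map (fst \<circ> prod_decode)" and ?g = "map (snd \<circ> prod_decode)"
  define E where "E s = C (?f s) \<inter> D (?g s)" for s
  have C: "closedin Y (C s)" "prefix s t \<Longrightarrow> C t \<subseteq> C s" "X = suslin_op C" "X = R_T T C" for s t
    using rep by (auto simp: closed_rep_def suslin_scheme_def)
  have "C [] \<subseteq> topspace Y" using closedin_subset[OF C(1)] .
  then have "X \<subseteq> topspace Y" unfolding C(4) R_T_def by blast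
  then have top: "topspace (subtopology Y X) = X" by (simp add: Int_absorb1)
  have D': "suslin_scheme X D" "suslin_op D = X" using D unfolding complete_on_def top by blast+
  have "suslin_scheme X E"
    unfolding suslin_scheme_def E_def
  proof (intro conjI allI impI)
    show "C (?f s) \<inter> D (?g s) \<subseteq> X" for s using D'(1) by (auto simp: suslin_scheme_def)
    show "C (?f t) \<inter> D (?g t) \<subseteq> C (?f s) \<inter> D (?g s)" if "prefix s t" for s t
      using C(2) D'(1) map_mono_prefix[OF that] unfolding suslin_scheme_def by blast
  qed
  moreover have "suslin_op E = X"
  proof
    have "suslin_op E \<subseteq> E []" 
      using suslin_op_subset_R_T[of E "{[]}"] by (simp add: R_T_singleton)
    then show "suslin_op E \<subseteq> X" using \<open>suslin_scheme X E\<close> by (auto simp: suslin_scheme_def)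
    show "X \<subseteq> suslin_op E"
    proof
      fix x assume "x \<in> X"
      then have "x \<in> suslin_op C" "x \<in> suslin_op D" using C(3) D'(2) by blast+
      then obtain \<sigma> \<tau> where "\<And>n. x \<in> C (map \<sigma> [0..<n])" "\<And>n. x \<in> D (map \<tau> [0..<n])"
        by (auto simp: suslin_op_def)
      then have "x \<in> E (map (\<lambda>n. prod_encode (\<sigma> n, \<tau> n)) [0..<n])" for n
        by (simp add: E_def comp_def)
      then show "x \<in> suslin_op E" unfolding suslin_op_def by blast
    qed
  qed
  ultimately have "complete_on (subtopology Y X) E"
    unfolding complete_on_def top
  proof (intro conjI allI impI)
    fix G assume G: "G \<noteq> bot \<and> eventually (\<lambda>x. x \<in> X) G \<and>
      (\<forall>n. \<exists>s. length s = n \<and> eventually (\<lambda>x. x \<in> E s) G)"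
    have "\<exists>s. length s = n \<and> eventually (\<lambda>x. x \<in> D s) G" for n
    proof -
      obtain s where "length s = n" "eventually (\<lambda>x. x \<in> E s) G" using G by blast
      then have "length (?g s) = n" "eventually (\<lambda>x. x \<in> D (?g s)) G"
        by (auto simp: E_def elim: eventually_mono)
      then show ?thesis by blast
    qed
    with G D show "\<exists>x\<in>X. \<forall>A. eventually (\<lambda>x. x \<in> A) G \<longrightarrow> x \<in> subtopology Y X closure_of A"
      unfolding complete_on_def top by blast
  qed
  moreover have "X = R_T T (closure_scheme Y E)"
  proof
    have "E s \<subseteq> closure_scheme Y E s" for s
    proof -
      have "E s \<subseteq> topspace Y"
        using \<open>suslin_scheme X E\<close> \<open>X \<subseteq> topspace Y\<close> by (auto simp: suslin_scheme_def)
      then show ?thesis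
        by (simp add: closure_scheme_def Int_absorb2 closure_of_subset)
    qed
    then have "suslin_op E \<subseteq> suslin_op (closure_scheme Y E)"
      unfolding suslin_op_def by (intro UN_mono INT_anti_mono) auto
    then show "X \<subseteq> R_T T (closure_scheme Y E)"
      using \<open>suslin_op E = X\<close> suslin_op_subset_R_T[of "closure_scheme Y E" T] by simp
    have "closure_scheme Y E s \<subseteq> C (?f s)" for s
      unfolding closure_scheme_def using C(1) by (intro closure_of_minimal) (auto simp: E_def)
    then have "R_T T (closure_scheme Y E) \<subseteq> R_T T C"
      by (rule R_T_mono) (auto intro: map_mono_prefix)
    then show "R_T T (closure_scheme Y E) \<subseteq> X" using C(4) by simp
  qed
  ultimately show ?thesis by blast
qed

section \<open>Assembling the equivalence over all classes\<close>

lemma suslin_scheme_closure_scheme: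
  "suslin_scheme X C \<Longrightarrow> suslin_scheme (topspace Y) (closure_scheme Y C)"
  unfolding suslin_scheme_def closure_scheme_def
  by (meson Int_mono closure_of_mono closure_of_subset_topspace order_refl)

context omega1_enum
begin

lemma canon_tree_w1: "canon_tree w1 \<pi> w1 = UNIV"
  using is_limit_w1 by (simp add: canon_tree_def fin_of_limit oprime_limit tree_w1)

text \<open>An odd class reduces to its even predecessor \<open>y\<close>: the sets in the union are
  raised to class \<open>y\<close>, and the stem \<open>[1]\<close> absorbs the union.\<close>

lemma Fborel_imp_closed_rep:
  assumes "Fborel Y w1 \<alpha> X"
  shows "\<exists>C. closed_rep Y (canon_tree w1 \<pi> \<alpha>) X C"
proof -
  consider "\<alpha> = w1" | "\<alpha> < w1" "even (fin_of \<alpha>)" | "\<alpha> < w1" "odd (fin_of \<alpha>)"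
    using le_w1[of \<alpha>] by (auto simp: order_le_less)
  then show ?thesis
  proof cases
    case 1
    from assms have "suslinF Y X"
      using 1 by cases auto
    then show ?thesis using closed_rep_suslinF 1 by (simp add: canon_tree_w1)
  next
    case 2
    then show ?thesis using Fborel_closed_rep assms by (simp add: canon_tree_def)
  next
    case 3
    from 3(2) obtain y where y: "y < \<alpha>" "\<alpha> = osucc y" "even (fin_of y)" by (rule odd_fin_of_cases)
    obtain b A where A: "\<And>n::nat. b n < \<alpha>" "\<And>n. Fborel Y w1 (b n) (A n)" "X = (\<Union>n. A n)"
      using assms 3 by (metis Fborel_oddE)
    have "y < w1" using y(1) 3(1) by simp
    moreover have "b n \<le> y" for n using A(1)[of n] y less_osucc_iff by blast
    ultimately have "Fborel Y w1 y (A n)" for n using A(2) Fborel_mono by blast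
    then have "\<exists>C. closed_rep Y (tree w1 \<pi> (oprime y)) (A n) C" for n
      using Fborel_closed_rep[OF \<open>y < w1\<close> y(3)] by blast
    then obtain C where "\<And>n. closed_rep Y (tree w1 \<pi> (oprime y)) (A n) (C n)" by metis
    then have "\<exists>D. closed_rep Y ({[]} \<union> {1 # s |s. s \<in> tree w1 \<pi> (oprime y)}) (\<Union>n. A n) D"
      by (intro closed_rep_odd) auto
    moreover have "oprime \<alpha> = oprime y" using y oprime_osucc[OF y(1)] by simp
    ultimately show ?thesis
      using 3(2) A(3) by (simp add: canon_tree_def)
  qed
qed

lemma Fborel_R_alpha:
  assumes "suslin_scheme (topspace Y) C" "\<And>s. closedin Y (C s)"
  shows "Fborel Y w1 \<alpha> (R_alpha w1 \<pi> \<alpha> C)"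
proof -
  consider "\<alpha> = w1" | "\<alpha> < w1" "even (fin_of \<alpha>)" | "\<alpha> < w1" "odd (fin_of \<alpha>)"
    using le_w1[of \<alpha>] by (auto simp: order_le_less)
  then show ?thesis
  proof cases
    case 1
    \<comment> \<open>\<open>suslin_op\<close> starts at the empty word and \<open>suslinF\<close>
      at words of length one; monotonicity of the scheme removes the difference.\<close>
    have "(\<Inter>n. C (map \<sigma> [0..<n])) = (\<Inter>k. C (map \<sigma> [0..<Suc k]))" for \<sigma>
    proof
      have "C (map \<sigma> [0..<Suc n]) \<subseteq> C (map \<sigma> [0..<n])" for n
        using assms(1) prefix_map_upt[of n "Suc n" \<sigma>] by (simp add: suslin_scheme_def del: upt_Suc)
      then show "(\<Inter>k. C (map \<sigma> [0..<Suc k])) \<subseteq> (\<Inter>n. C (map \<sigma> [0..<n]))" by blast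
    qed blast
    then have "suslinF Y (suslin_op C)"
      unfolding suslinF_def suslin_op_def using assms(2) by auto
    then show ?thesis
      unfolding R_alpha_def 1 canon_tree_w1 R_T_UNIV by (rule Fborel.F_omega1)
  next
    case 2
    then show ?thesis
      using Fborel_R_T_tree[OF _ _ assms(2)] by (simp add: R_alpha_def canon_tree_def)
  next
    case 3
    from 3(2) obtain y where y: "y < \<alpha>" "\<alpha> = osucc y" "even (fin_of y)" by (rule odd_fin_of_cases)
    have sub: "C s \<subseteq> C []" for s using assms(1) by (simp add: suslin_scheme_def)
    have "Fborel Y w1 y (R_T (tree w1 \<pi> (oprime y)) (\<lambda>s. C (m # s)))" for m
      using y 3(1) assms(2) by (intro Fborel_R_T_tree) auto
    then have "Fborel Y w1 (osucc y) (\<Union>m. R_T (tree w1 \<pi> (oprime y)) (\<lambda>s. C (m # s)))"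
      using y 3(1) by (intro Fborel_Union[OF y(1)]) auto
    moreover have "oprime \<alpha> = oprime y" using y oprime_osucc[OF y(1)] by simp
    ultimately show ?thesis
      using 3(2) R_T_odd[of "tree w1 \<pi> (oprime y)" C, OF Nil_in_tree sub] y(2)
      by (simp add: R_alpha_def canon_tree_def)
  qed
qed

end

theorem theorem6p11:
  fixes Y :: "'a topology" and X :: "'a set"
    and w1 :: "'o::wellorder" and \<pi> :: "'o \<Rightarrow> nat \<Rightarrow> 'o" and \<alpha> :: "'o"
    and K :: "'k topology" and e :: "'a \<Rightarrow> 'k"
  assumes w1: "omega1_top w1"
    and pi: "\<And>\<beta>. \<beta> < w1 \<Longrightarrow> is_limit \<beta> \<Longrightarrow> bij_betw (\<pi> \<beta>) UNIV {\<gamma>. \<gamma> < \<beta>}"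
    and Y: "tychonoff_space Y"
    and XY: "X \<subseteq> topspace Y"
    and Kan: "K_analytic_via K e (subtopology Y X)"
  shows "(Fborel Y w1 \<alpha> X
            \<longleftrightarrow> (\<exists>C. suslin_scheme (topspace Y) C \<and> (\<forall>s. closedin Y (C s))
                     \<and> X = R_alpha w1 \<pi> \<alpha> C))
       \<and> (Fborel Y w1 \<alpha> X
            \<longleftrightarrow> (\<exists>C. suslin_scheme X C \<and> X = R_alpha_in w1 \<pi> \<alpha> C Y))
       \<and> (Fborel Y w1 \<alpha> X
            \<longleftrightarrow> (\<exists>C. complete_on (subtopology Y X) C \<and> X = R_alpha_in w1 \<pi> \<alpha> C Y))"
    (is "(?F \<longleftrightarrow> ?P2) \<and> (?F \<longleftrightarrow> ?P3) \<and> (?F \<longleftrightarrow> ?P4)")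
proof -
  interpret omega1_enum w1 \<pi> by standard (fact w1, fact pi)
  \<comment> \<open>The implications form the cycle \<open>?F\<close>, \<open>?P4\<close>,
    \<open>?P3\<close>, \<open>?P2\<close>, \<open>?F\<close>. From \<open>?P3\<close> to
    \<open>?P2\<close> the closure scheme itself serves as the closed scheme.\<close>
  have "?P4" if ?F
  proof -
    obtain C where "closed_rep Y (canon_tree w1 \<pi> \<alpha>) X C"
      using Fborel_imp_closed_rep[OF \<open>?F\<close>] by blast
    moreover obtain D where "complete_on (subtopology Y X) D"
      using K_analytic_complete_scheme[OF Kan] by blast
    ultimately show ?P4
      unfolding R_alpha_in_def by (rule closed_rep_complete_scheme)
  qed
  moreover have ?P3 if ?P4
    using that XY by (auto simp: complete_on_def Int_absorb1)
  moreover have ?P2 if ?P3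
  proof -
    obtain C where "suslin_scheme X C" "X = R_alpha_in w1 \<pi> \<alpha> C Y" using \<open>?P3\<close> by blast
    moreover have "closedin Y (closure_scheme Y C s)" for s by (simp add: closure_scheme_def)
    ultimately show ?P2
      using suslin_scheme_closure_scheme unfolding R_alpha_in_def R_alpha_def by blast
  qed
  moreover have ?F if ?P2
    using that Fborel_R_alpha by blast
  ultimately show ?thesis by blast
qed

end
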